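(* For all integers $n\ge 0$ and $r\ge 0$, \[ F_n^{(r)}=F_{n+2r}-\sum_{k=0}^{r-1} \binom{n+r+k}{r-1-k}. \]
   Context: $(F_n)_{n\ge 0}$ is the Fibonacci sequence with $F_0=0$, $F_1=1$, $F_{n+2}=F_{n+1}+F_n$. The hyperfibonacci sequence of $r$-th generation $(F_n^{(r)})_{n\ge 0}$ is defined by $F_n^{(0)}=F_n$ and, for $r\ge 1$, $F_n^{(r)}=\sum_{k=0}^n F_k^{(r-1)}$ (so $F_0^{(r)}=0$ and $F_1^{(r)}=1$). An empty sum is $0$. *)

theory Defs
  imports "HOL-Number_Theory.Fib"
begin

text \<open>
  The generation is the first argument: \<open>hyperfib r n\<close> is $F_n^{(r)}$.
\<close>

primrec hyperfib :: "nat \<Rightarrow> nat \<Rightarrow> nat" where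
  "hyperfib 0 n = fib n"
| "hyperfib (Suc r) n = (\<Sum>k=0..n. hyperfib r k)"

end

theory Submission
  imports Defs
begin

text \<open>
  Both sides satisfy the recurrence $a^{(r+1)}_{n+1} = a^{(r+1)}_n + a^{(r)}_{n+1}$: the
  Fibonacci term by its own recurrence, the binomial sum by Pascal's rule. At $n = 0$ the
  binomial sum is the diagonal sum of Pascal's triangle that equals $F_{2r}$.
\<close>

lemma sum_choose_Suc_Suc:
  fixes n r :: nat
  shows "(\<Sum>k<Suc r. (Suc n + Suc r + k) choose (r - k)) =
    (\<Sum>k<Suc r. (n + Suc r + k) choose (r - k)) +
    (\<Sum>k<r. (Suc n + r + k) choose (r - 1 - k))"
proof -
  \<comment> \<open>Pascal's rule is limited to \<open>k < r\<close>: at \<open>k = r\<close> the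
    lower index is 0, so that term is 1 in both longer sums and cancels.\<close>
  have "((Suc n + Suc r + k) choose (r - k)) =
      ((n + Suc r + k) choose (r - k)) + ((Suc n + r + k) choose (r - 1 - k))" if k: "k < r" for k
  proof -
    obtain d where "r - k = Suc d" "r - 1 - k = d"
      using k by (cases "r - k") auto
    then show ?thesis by simp
  qed
  then have "(\<Sum>k<r. (Suc n + Suc r + k) choose (r - k)) =
      (\<Sum>k<r. (n + Suc r + k) choose (r - k)) + (\<Sum>k<r. (Suc n + r + k) choose (r - 1 - k))"
    by (subst sum.distrib [symmetric], intro sum.cong) auto
  then show ?thesis by simp
qed

lemma sum_choose_eq_fib_double:
  "(\<Sum>k<r. (r + k) choose (r - 1 - k)) = fib (2 * r)"
proof (cases r)
  case 0
  then show ?thesis by simp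
next
  case (Suc m)
  \<comment> \<open>Reversing the order by \<open>j = m - k\<close> turns the sum into a shallow
    diagonal.\<close>
  have "(\<Sum>k<r. (r + k) choose (r - 1 - k)) = (\<Sum>j<r. (2 * m + 1 - j) choose j)"
    by (rule sum.reindex_bij_witness [of _ "\<lambda>j. m - j" "\<lambda>k. m - k"]) (auto simp: Suc)
  \<comment> \<open>For \<open>j > m\<close> the upper index is below \<open>j\<close>, so the added
    terms vanish.\<close>
  also have "\<dots> = (\<Sum>j = 0..2 * m + 1. (2 * m + 1 - j) choose j)"
    by (rule sum.mono_neutral_left) (auto simp: Suc binomial_eq_0)
  also have "\<dots> = fib (2 * r)"
    using ne_diagonal_fib [of "2 * m + 1"] by (simp add: Suc)
  finally show ?thesis .
qed

text \<open>The additive form avoids truncated subtraction on naturals. In the induction on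
  \<open>r\<close>, \<open>n\<close> stays arbitrary because the recurrence calls on generation
  \<open>r\<close> at \<open>Suc n\<close>.\<close>

lemma hyperfib_add_sum_choose:
  "hyperfib r n + (\<Sum>k<r. (n + r + k) choose (r - 1 - k)) = fib (n + 2 * r)"
proof (induction r arbitrary: n)
  case 0
  then show ?case by simp
next
  case IH: (Suc r)
  show ?case
  proof (induction n)
    case 0
    \<comment> \<open>The one-term sum is \<open>hyperfib r 0\<close>; the hypothesis at 0 reads
      \<open>hyperfib r 0 + fib (2 * r) = fib (2 * r)\<close>.\<close>
    have "hyperfib (Suc r) 0 = 0"
      using IH.IH [of 0] sum_choose_eq_fib_double [of r] by simp
    then show ?case
      using sum_choose_eq_fib_double [of "Suc r"] by simp
  next
    case (Suc n)
    have "fib (Suc n + 2 * Suc r) = fib (n + 2 * Suc r) + fib (Suc n + 2 * r)"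
      by simp
    moreover have "hyperfib (Suc r) (Suc n) = hyperfib (Suc r) n + hyperfib r (Suc n)"
      by simp
    ultimately show ?case
      using Suc.IH IH.IH [of "Suc n"] sum_choose_Suc_Suc [of n r]
      by simp
  qed
qed

theorem theorem2:
  fixes n r :: nat
  shows "int (hyperfib r n) =
    int (fib (n + 2 * r)) - (\<Sum>k<r. int ((n + r + k) choose (r - 1 - k)))"
  using arg_cong [OF hyperfib_add_sum_choose, of int r n] by simp

end
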